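(* For every $t\ge1$ and every $n$, $\chi^{\mathrm{CF}}_{\mathrm{tree}}(\mathrm{balls};t;n)\le \lceil \log t\rceil+3$.
   Context: A network space is a 1-dimensional space with the topology of a graph (nodes are points, edges are simple curves of finite length joining pairs of nodes, otherwise disjoint); nodes have degree 1 (leaves) or at least 3 (internal nodes). $d$ is the geodesic distance. A tree space is a network space whose graph is a tree. Balls are $B(p,r)=\{q: d(p,q)\le r\}$. For a set $\mathcal{A}$ of objects and a point $p$, $S_p=\{o\in\mathcal{A}:p\in o\}$; a coloring is conflict-free if for every $p$ with $S_p\neq\emptyset$ some object of $S_p$ has a color different from all other objects of $S_p$. $\chi^{\mathrm{CF}}_{\mathrm{tree}}(\mathrm{balls};t;n)$ is the minimum number of colors sufficient to CF-color any set of $n$ balls in any tree space with $t$ internal nodes. $\log$ denotes the base-2 logarithm. *)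

theory Defs
  imports Complex_Main "HOL-Library.Extended_Nat"
begin

(* The edge e is the curve "curve N e" restricted to {0..len N e}. Every curve of finite
   length has an arc-length parametrization, and this is the parametrization recorded here:
   the piece of e between the parameters s and t has length |s - t|. *)
record ('p, 'e) network =
  nodes :: "'p set"
  edges :: "'e set"
  len :: "'e \<Rightarrow> real"
  curve :: "'e \<Rightarrow> real \<Rightarrow> 'p"

definition points :: "('p, 'e) network \<Rightarrow> 'p set" where
  "points N = nodes N \<union> (\<Union>e\<in>edges N. curve N e ` {0..len N e})"

definition ends :: "('p, 'e) network \<Rightarrow> 'e \<Rightarrow> 'p set" where
  "ends N e = {curve N e 0, curve N e (len N e)}"

definition edge_interior :: "('p, 'e) network \<Rightarrow> 'e \<Rightarrow> 'p set" where
  "edge_interior N e = curve N e ` {0<..<len N e}"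

(* There are no loops in a network space, so this is the usual degree. *)
definition degree :: "('p, 'e) network \<Rightarrow> 'p \<Rightarrow> nat" where
  "degree N v = card {e \<in> edges N. v \<in> ends N e}"

definition internal_nodes :: "('p, 'e) network \<Rightarrow> 'p set" where
  "internal_nodes N = {v \<in> nodes N. degree N v \<ge> 3}"

definition network_space :: "('p, 'e) network \<Rightarrow> bool" where
  "network_space N \<longleftrightarrow>
     finite (nodes N) \<and> nodes N \<noteq> {} \<and> finite (edges N) \<and>
     (\<forall>e\<in>edges N. len N e > 0 \<and> inj_on (curve N e) {0..len N e} \<and>
        ends N e \<subseteq> nodes N \<and> edge_interior N e \<inter> nodes N = {}) \<and>
     (\<forall>e\<in>edges N. \<forall>f\<in>edges N. e \<noteq> f \<longrightarrow> edge_interior N e \<inter> edge_interior N f = {}) \<and>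
     (\<forall>v\<in>nodes N. degree N v = 1 \<or> degree N v \<ge> 3)"

definition graph_connected :: "('p, 'e) network \<Rightarrow> bool" where
  "graph_connected N \<longleftrightarrow>
     (\<forall>u\<in>nodes N. \<forall>v\<in>nodes N. (u, v) \<in> {(x, y). \<exists>e\<in>edges N. ends N e = {x, y}}\<^sup>*)"

(* vs lists the nodes and es the edges of a cycle; the edges are listed separately because
   two parallel edges form a cycle of length 2. *)
definition graph_cycle :: "('p, 'e) network \<Rightarrow> 'p list \<Rightarrow> 'e list \<Rightarrow> bool" where
  "graph_cycle N vs es \<longleftrightarrow>
     vs \<noteq> [] \<and> length es = length vs \<and> distinct vs \<and> distinct es \<and>
     set vs \<subseteq> nodes N \<and> set es \<subseteq> edges N \<and>
     (\<forall>i<length vs. ends N (es ! i) = {vs ! i, vs ! (Suc i mod length vs)})"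

definition tree_space :: "('p, 'e) network \<Rightarrow> bool" where
  "tree_space N \<longleftrightarrow> network_space N \<and> graph_connected N \<and> (\<nexists>vs es. graph_cycle N vs es)"

(* "path_of_length N p q l": some path from p to q, a finite concatenation of pieces of
   edges, has length l. *)
inductive path_of_length :: "('p, 'e) network \<Rightarrow> 'p \<Rightarrow> 'p \<Rightarrow> real \<Rightarrow> bool" for N where
  refl: "p \<in> points N \<Longrightarrow> path_of_length N p p 0"
| step: "e \<in> edges N \<Longrightarrow> s \<in> {0..len N e} \<Longrightarrow> t \<in> {0..len N e} \<Longrightarrow>
    path_of_length N (curve N e t) q l \<Longrightarrow>
    path_of_length N (curve N e s) q (\<bar>s - t\<bar> + l)"

(* Meaningful when the graph is connected; otherwise the infimum may be over the empty set. *)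
definition geodesic_dist :: "('p, 'e) network \<Rightarrow> 'p \<Rightarrow> 'p \<Rightarrow> real" where
  "geodesic_dist N p q = Inf {l. path_of_length N p q l}"

definition net_ball :: "('p, 'e) network \<Rightarrow> 'p \<Rightarrow> real \<Rightarrow> 'p set" where
  "net_ball N p r = {q \<in> points N. geodesic_dist N p q \<le> r}"

definition net_balls :: "('p, 'e) network \<Rightarrow> 'p set set" where
  "net_balls N = {net_ball N p r | p r. p \<in> points N \<and> r \<ge> 0}"

definition objects_at :: "'p set set \<Rightarrow> 'p \<Rightarrow> 'p set set" where
  "objects_at A p = {B \<in> A. p \<in> B}"

definition conflict_free :: "'p set \<Rightarrow> 'p set set \<Rightarrow> ('p set \<Rightarrow> nat) \<Rightarrow> bool" where
  "conflict_free X A col \<longleftrightarrow>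
     (\<forall>p\<in>X. objects_at A p \<noteq> {} \<longrightarrow>
        (\<exists>B\<in>objects_at A p. \<forall>B'\<in>objects_at A p. B' \<noteq> B \<longrightarrow> col B' \<noteq> col B))"

definition CF_colorable :: "'p set \<Rightarrow> 'p set set \<Rightarrow> nat \<Rightarrow> bool" where
  "CF_colorable X A k \<longleftrightarrow> (\<exists>col. col ` A \<subseteq> {..<k} \<and> conflict_free X A col)"

(* The type argument is the ambient type of points and edge names. The minimum is taken in
   enat, so that it would be infinity if no number of colors were sufficient. *)
definition chi_CF_tree_balls :: "('p \<times> 'e) itself \<Rightarrow> nat \<Rightarrow> nat \<Rightarrow> enat" where
  "chi_CF_tree_balls T t n = Inf {enat k | k.
     \<forall>(N :: ('p, 'e) network) A.
       tree_space N \<and> card (internal_nodes N) = t \<and>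
       A \<subseteq> net_balls N \<and> finite A \<and> card A = n \<longrightarrow>
       CF_colorable (points N) A k}"

end

(* Remove an internal node v that is a centroid and let B be the ball through v with the
   largest excess, that is, radius minus distance from the center to v. Inside a branch at v,
   the ball B contains everything that is covered by balls through v centered outside the
   branch. So if B gets a color of its own, every point outside B only sees balls centered in
   its own branch, and the branches can be colored independently with the same colors. Each
   halving of the number of internal nodes costs one color. At the end at most one internal
   node is left: every branch is then an interval, a minimal cover of it by balls is colored
   alternatingly, and the color of B can be reused, so two colors suffice, plus a dummy color
   for the redundant balls. All of this only uses the metric betweenness relation of the tree.
   The geodesic metric has the required properties because a tree grows edge by edge. *)
theory Submission
  imports Defs
begin

definition between :: "('p \<Rightarrow> 'p \<Rightarrow> real) \<Rightarrow> 'p \<Rightarrow> 'p \<Rightarrow> 'p \<Rightarrow> bool" where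
  "between d x z y \<longleftrightarrow> d x z + d z y = d x y"

(* Color 0 is a dummy color: it never serves as the unique color at a point. *)
definition cf_on :: "'p set \<Rightarrow> 'i set \<Rightarrow> ('i \<Rightarrow> 'p set) \<Rightarrow> ('i \<Rightarrow> nat) \<Rightarrow> bool" where
  "cf_on Y F b col \<longleftrightarrow> (\<forall>x\<in>Y. (\<exists>i\<in>F. x \<in> b i) \<longrightarrow>
     (\<exists>i\<in>F. x \<in> b i \<and> col i \<noteq> 0 \<and> (\<forall>j\<in>F. x \<in> b j \<and> j \<noteq> i \<longrightarrow> col j \<noteq> col i)))"

section \<open>Coloring balls in a tree metric\<close>

text \<open>An inclusion-minimal subfamily with the same union on \<open>K - S\<close> gives each
  member a private point. In the order of these points only neighbors meet inside \<open>K\<close>,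
  so alternating 1 and 2 works, and all other members get 0. \<open>S\<close> is an initial segment
  that only the leftmost member can reach, so 2 stays free there.\<close>

lemma cf_on_intervals:
  fixes \<phi> :: "'p \<Rightarrow> real" and b :: "'i \<Rightarrow> 'p set"
  assumes fin: "finite G"
    and conv: "\<And>i x y z. \<lbrakk>i \<in> G; x \<in> b i; y \<in> b i; x \<in> K; y \<in> K; z \<in> K; \<phi> x \<le> \<phi> z; \<phi> z \<le> \<phi> y\<rbrakk> \<Longrightarrow> z \<in> b i"
    and down: "\<And>x z. \<lbrakk>x \<in> S; x \<in> K; z \<in> K; \<phi> z \<le> \<phi> x\<rbrakk> \<Longrightarrow> z \<in> S"
  shows "\<exists>col. (\<forall>i. col i \<le> 2) \<and> cf_on (K - S) G b col \<and>
           (\<forall>i\<in>G. col i = 2 \<longrightarrow> b i \<inter> S \<inter> K = {})"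
proof -
  define cov where "cov C = (K - S) \<inter> \<Union> (b ` C)" for C
  define Cs where "Cs = {C. C \<subseteq> G \<and> cov C = cov G}"
  have "finite Cs" "G \<in> Cs" using fin by (auto simp: Cs_def)
  then obtain C where C: "C \<in> Cs" "\<And>C'. C' \<in> Cs \<Longrightarrow> C' \<subseteq> C \<Longrightarrow> C = C'"
    using finite_has_minimal2[of Cs G] by blast
  have CG: "C \<subseteq> G" and covC: "cov C = cov G" using C(1) by (auto simp: Cs_def)
  have finC: "finite C" using CG fin finite_subset by blast
  have "\<exists>x. x \<in> K - S \<and> x \<in> b i \<and> (\<forall>j\<in>C. j \<noteq> i \<longrightarrow> x \<notin> b j)" if i: "i \<in> C" for i
  proof (rule ccontr)
    assume neg: "\<not> ?thesis"
    have "cov (C - {i}) = cov C"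
      using neg i unfolding cov_def by fastforce
    then have "C - {i} \<in> Cs" using CG covC by (auto simp: Cs_def)
    then have "C = C - {i}" using C(2) by blast
    then show False using i by blast
  qed
  then obtain x where x: "\<And>i. i \<in> C \<Longrightarrow> x i \<in> K - S \<and> x i \<in> b i \<and> (\<forall>j\<in>C. j \<noteq> i \<longrightarrow> x i \<notin> b j)"
    by metis
  define rk where "rk i = card {j \<in> C. \<phi> (x j) < \<phi> (x i)}" for i
  define col where "col i = (if i \<notin> C then 0 else if even (rk i) then 1 else 2 :: nat)" for i
  have rk_Suc: "rk j = Suc (rk i)"
    if ij: "i \<in> C" "j \<in> C" "\<phi> (x i) < \<phi> (x j)" and y: "y \<in> K" "y \<in> b i" "y \<in> b j" for i j y
  proof -
    \<comment> \<open>A third private point between \<open>x i\<close> and \<open>x j\<close> would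
      lie on one side of the common point \<open>y\<close> and hence in \<open>b i\<close> or in
      \<open>b j\<close>.\<close>
    have no: "\<not> (\<phi> (x i) \<le> \<phi> (x k) \<and> \<phi> (x k) \<le> \<phi> (x j))" if k: "k \<in> C" "k \<noteq> i" "k \<noteq> j" for k
    proof
      assume a: "\<phi> (x i) \<le> \<phi> (x k) \<and> \<phi> (x k) \<le> \<phi> (x j)"
      have "x k \<in> K" "x k \<notin> b i" "x k \<notin> b j" using x k ij by auto
      then show False
        using conv[of i "x i" y "x k"] conv[of j y "x j" "x k"] a x[OF ij(1)] x[OF ij(2)] y
          subsetD[OF CG ij(1)] subsetD[OF CG ij(2)]
        by (cases "\<phi> (x k) \<le> \<phi> y") auto
    qed
    have "{k \<in> C. \<phi> (x k) < \<phi> (x j)} = insert i {k \<in> C. \<phi> (x k) < \<phi> (x i)}"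
      using no ij by force
    then show ?thesis unfolding rk_def using finC by simp
  qed
  have neq: "col i \<noteq> col j"
    if ij: "i \<in> C" "j \<in> C" "i \<noteq> j" and y: "y \<in> K" "y \<in> b i" "y \<in> b j" for i j y
  proof -
    have "\<phi> (x i) \<noteq> \<phi> (x j)"
      using conv[of i "x i" "x i" "x j"] x[OF ij(1)] x[OF ij(2)] ij CG by auto
    then have "rk j = Suc (rk i) \<or> rk i = Suc (rk j)"
      using rk_Suc[OF ij(1,2) _ y(1-3)] rk_Suc[OF ij(2,1) _ y(1,3,2)] by linarith
    then show ?thesis using ij by (auto simp: col_def)
  qed
  have "cf_on (K - S) G b col"
    unfolding cf_on_def
  proof (intro ballI impI)
    fix y assume y: "y \<in> K - S" and "\<exists>i\<in>G. y \<in> b i"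
    then have "y \<in> cov C" unfolding covC by (auto simp: cov_def)
    then obtain i where i: "i \<in> C" "y \<in> b i" by (auto simp: cov_def)
    have "col j \<noteq> col i" if "j \<in> G" "y \<in> b j" "j \<noteq> i" for j
    proof (cases "j \<in> C")
      case True then show ?thesis using neq[of i j y] i that y by auto
    next
      case False then show ?thesis using i by (auto simp: col_def)
    qed
    moreover have "col i \<noteq> 0" using i by (simp add: col_def)
    ultimately show "\<exists>i\<in>G. y \<in> b i \<and> col i \<noteq> 0 \<and> (\<forall>j\<in>G. y \<in> b j \<and> j \<noteq> i \<longrightarrow> col j \<noteq> col i)"
      using i CG by blast
  qed
  moreover have "b i \<inter> S \<inter> K = {}" if i: "i \<in> G" "col i = 2" for i
  proof (rule ccontr)
    assume "b i \<inter> S \<inter> K \<noteq> {}"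
    then obtain y where y: "y \<in> b i" "y \<in> S" "y \<in> K" by blast
    \<comment> \<open>An odd rank is positive, so another private point lies to the left of
      \<open>x i\<close>. Being outside \<open>S\<close>, it lies to the right of \<open>y\<close>,
      and convexity forces it into \<open>b i\<close>.\<close>
    have iC: "i \<in> C" and odd: "odd (rk i)" using i(2) by (auto simp: col_def split: if_splits)
    then have "{j \<in> C. \<phi> (x j) < \<phi> (x i)} \<noteq> {}" unfolding rk_def by (metis card.empty even_zero)
    then obtain k where k: "k \<in> C" "\<phi> (x k) < \<phi> (x i)" by blast
    have "\<phi> y < \<phi> (x k)" using down[of y "x k"] y x[OF k(1)] by force
    then have "x k \<in> b i" using conv[of i y "x i" "x k"] y k x[OF k(1)] x[OF iC] i by auto
    then show False using x[OF k(1)] iC k by auto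
  qed
  ultimately show ?thesis by (intro exI[of _ col]) (auto simp: col_def)
qed

text \<open>These are the features of a tree that the coloring uses: \<open>separation\<close> makes
  the components left after removing a point into equivalence classes, and \<open>median\<close>
  places every true branching point in \<open>V\<close>.\<close>

locale tree_metric =
  fixes X :: "'p set" and d :: "'p \<Rightarrow> 'p \<Rightarrow> real" and V :: "'p set"
  assumes V_subset: "V \<subseteq> X"
    and dist_refl: "x \<in> X \<Longrightarrow> d x x = 0"
    and dist_eqD: "\<lbrakk>x \<in> X; y \<in> X; d x y = 0\<rbrakk> \<Longrightarrow> x = y"
    and dist_sym: "\<lbrakk>x \<in> X; y \<in> X\<rbrakk> \<Longrightarrow> d x y = d y x"
    and triangle: "\<lbrakk>x \<in> X; y \<in> X; z \<in> X\<rbrakk> \<Longrightarrow> d x z \<le> d x y + d y z"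
    and separation: "\<lbrakk>p \<in> X; q \<in> X; r \<in> X; v \<in> X; between d p v r\<rbrakk> \<Longrightarrow> between d p v q \<or> between d q v r"
    and median: "\<lbrakk>p \<in> X; q \<in> X; r \<in> X\<rbrakk> \<Longrightarrow>
      \<exists>m\<in>{p, q, r} \<union> V. between d p m q \<and> between d q m r \<and> between d p m r"
begin

section \<open>Convex sets and the branches at a point\<close>

lemma dist_nonneg: "\<lbrakk>x \<in> X; y \<in> X\<rbrakk> \<Longrightarrow> 0 \<le> d x y"
  using triangle[of x y x] dist_refl[of x] dist_sym[of x y] by auto

lemma between_sym: "\<lbrakk>x \<in> X; y \<in> X; z \<in> X; between d x z y\<rbrakk> \<Longrightarrow> between d y z x"
  using dist_sym by (auto simp: between_def)

text \<open>The metric counterpart of a subtree; the induction in \<open>cf_on_balls\<close> runs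
  over such sets.\<close>

definition metric_convex :: "'p set \<Rightarrow> bool" where
  "metric_convex R \<longleftrightarrow> R \<subseteq> X \<and> (\<forall>p\<in>R. \<forall>q\<in>R. \<forall>x\<in>X. between d p x q \<longrightarrow> x \<in> R)"

lemma metric_convexD: "\<lbrakk>metric_convex R; p \<in> R; q \<in> R; x \<in> X; between d p x q\<rbrakk> \<Longrightarrow> x \<in> R"
  unfolding metric_convex_def by blast

text \<open>The component of \<open>R\<close> minus \<open>v\<close> that contains \<open>w\<close>;
  it is empty when \<open>w = v\<close>.\<close>

definition branch :: "'p set \<Rightarrow> 'p \<Rightarrow> 'p \<Rightarrow> 'p set" where
  "branch R v w = {x \<in> R. \<not> between d x v w}"

text \<open>If \<open>v\<close> separated \<open>x\<close> from \<open>w\<close>, it would separate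
  \<open>x\<close> from \<open>p\<close>. As \<open>x\<close> is between \<open>p\<close> and
  \<open>q\<close>, the triangle inequality would then put \<open>v\<close> between \<open>p\<close>
  and \<open>q\<close>, which is impossible for two points of one branch.\<close>

lemma metric_convex_branch:
  assumes R: "metric_convex R" and v: "v \<in> R" and w: "w \<in> R"
  shows "metric_convex (branch R v w)"
  unfolding metric_convex_def
proof (intro conjI ballI impI)
  have RX: "R \<subseteq> X" using R by (simp add: metric_convex_def)
  then show "branch R v w \<subseteq> X" by (auto simp: branch_def)
  fix p q x assume p: "p \<in> branch R v w" and q: "q \<in> branch R v w" and x: "x \<in> X" and b: "between d p x q"
  have pq: "p \<in> R" "q \<in> R" "\<not> between d p v w" "\<not> between d q v w" using p q by (auto simp: branch_def)
  have xR: "x \<in> R" using metric_convexD[OF R pq(1,2) x b] .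
  have X: "p \<in> X" "q \<in> X" "v \<in> X" "w \<in> X" using pq v w RX by auto
  have npq: "\<not> between d p v q"
    using separation[of p w q v] pq X between_sym by blast
  have "\<not> between d x v w"
  proof
    assume "between d x v w"
    then have "between d x v p" using separation[of x p w v] pq X x by blast
    then have "between d p v q"
      using b triangle[of p v q] triangle[of v x q] X x dist_sym[of v p] dist_sym[of x p] dist_sym[of x v]
      unfolding between_def by linarith
    then show False using npq by simp
  qed
  then show "x \<in> branch R v w" using xR by (simp add: branch_def)
qed

lemma self_in_branch: "\<lbrakk>x \<in> R; R \<subseteq> X; v \<in> R; x \<noteq> v\<rbrakk> \<Longrightarrow> x \<in> branch R v x"
  using dist_nonneg[of x v] dist_eqD[of x v] dist_sym[of x v] dist_refl[of x] subsetD[of R X x] subsetD[of R X v]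
  by (auto simp: branch_def between_def)

lemma center_not_in_branch: "\<lbrakk>R \<subseteq> X; v \<in> R\<rbrakk> \<Longrightarrow> v \<notin> branch R v w"
  using dist_refl[of v] subsetD[of R X v] by (auto simp: branch_def between_def)

text \<open>By \<open>separation\<close>, not being separated by \<open>v\<close> is transitive, so
  any point of a branch can represent it.\<close>

lemma branch_eq:
  assumes "R \<subseteq> X" "v \<in> R" "w \<in> R" "x \<in> branch R v w"
  shows "branch R v x = branch R v w"
proof -
  have X: "x \<in> X" "v \<in> X" "w \<in> X" "x \<in> R" "\<not> between d x v w" using assms by (auto simp: branch_def)
  have "between d y v x \<longleftrightarrow> between d y v w" if "y \<in> R" for y
    using separation[of y x w v] separation[of y w x v] X subsetD[OF assms(1) that] between_sym[of w x v]
    by blast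
  then show ?thesis by (auto simp: branch_def)
qed

text \<open>A node minimizing the sum of distances to all nodes of \<open>R\<close> works: if one
  branch held more than half of them, moving to its node nearest to \<open>v\<close> would shorten
  the sum.\<close>

lemma centroid:
  assumes R: "metric_convex R" and fin: "finite (V \<inter> R)" and ne: "V \<inter> R \<noteq> {}"
  shows "\<exists>v\<in>V \<inter> R. \<forall>w\<in>R. 2 * card (V \<inter> branch R v w) \<le> card (V \<inter> R)"
proof -
  define W where "W = V \<inter> R"
  define f where "f v = (\<Sum>u\<in>W. d v u)" for v
  have RX: "R \<subseteq> X" using R by (simp add: metric_convex_def)
  have WX: "W \<subseteq> X" using V_subset by (auto simp: W_def)
  have finW: "finite W" "W \<noteq> {}" using fin ne by (auto simp: W_def)
  obtain v where v: "v \<in> W" and vmin: "\<And>u. u \<in> W \<Longrightarrow> f v \<le> f u"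
    using ex_min_if_finite[of "f ` W"] finW by (metis (no_types, lifting) arg_min_if_finite(1) arg_min_least)
  have vX: "v \<in> X" and vR: "v \<in> R" using v WX by (auto simp: W_def)
  have "2 * card (V \<inter> branch R v w) \<le> card W" if w: "w \<in> R" for w
  proof (rule ccontr)
    assume neg: "\<not> ?thesis"
    define K where "K = branch R v w"
    define U where "U = V \<inter> K"
    have KR: "K \<subseteq> R" by (auto simp: K_def branch_def)
    have cK: "metric_convex K" unfolding K_def using metric_convex_branch[OF R vR w] .
    have vK: "v \<notin> K" unfolding K_def using center_not_in_branch[OF RX vR] .
    have UW: "U \<subseteq> W" using KR by (auto simp: U_def W_def)
    have finU: "finite U" using UW finW finite_subset by blast
    have "U \<noteq> {}" using neg by (auto simp: U_def K_def)
    then obtain c where c: "c \<in> U" and cmin: "\<And>u. u \<in> U \<Longrightarrow> d v c \<le> d v u"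
      using finU by (metis (no_types, lifting) arg_min_if_finite(1) arg_min_least)
    have cX: "c \<in> X" and cK': "c \<in> K" using c UW WX by (auto simp: U_def)
    have cv: "0 < d v c"
      using dist_nonneg[OF vX cX] dist_eqD[OF vX cX] cK' vK by force
    \<comment> \<open>The median of \<open>v\<close>, \<open>c\<close> and \<open>u\<close> lies in
      the branch by convexity, so it is a node of \<open>U\<close>, no nearer to \<open>v\<close>
      than \<open>c\<close>. Being between \<open>v\<close> and \<open>c\<close>, it equals
      \<open>c\<close>.\<close>
    have near: "d c u = d v u - d v c" if u: "u \<in> U" for u
    proof -
      have uX: "u \<in> X" and uK: "u \<in> K" using u UW WX by (auto simp: U_def)
      obtain m where m: "m \<in> {v, c, u} \<union> V" "between d v m c" "between d c m u" "between d v m u"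
        using median[OF vX cX uX] by blast
      have mX: "m \<in> X" using m(1) vX cX uX V_subset by auto
      have mK: "m \<in> K" using metric_convexD[OF cK cK' uK mX m(3)] .
      then have "m \<in> U" using m(1) vK c u by (auto simp: U_def)
      then have "d v c \<le> d v m" using cmin by blast
      then have "d m c = 0" using m(2) dist_nonneg[OF mX cX] by (simp add: between_def)
      then have "m = c" using dist_eqD mX cX by blast
      then show ?thesis using m(4) by (simp add: between_def)
    qed
    have far: "d c u \<le> d v u + d v c" if u: "u \<in> W" for u
      using triangle[of c v u] dist_sym[of c v] cX vX u WX by auto
    \<comment> \<open>Moving from \<open>v\<close> to \<open>c\<close> gains \<open>d v c\<close> at
      each node of \<open>U\<close> and loses at most that at each of the fewer other nodes.\<close>
    have "f c = (\<Sum>u\<in>U. d c u) + (\<Sum>u\<in>W - U. d c u)"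
      unfolding f_def using sum.subset_diff[OF UW finW(1)] by (simp add: add.commute)
    also have "\<dots> \<le> (\<Sum>u\<in>U. d v u - d v c) + (\<Sum>u\<in>W - U. d v u + d v c)"
      by (intro add_mono sum_mono) (auto simp: near far)
    also have "\<dots> = (\<Sum>u\<in>U. d v u) + (\<Sum>u\<in>W - U. d v u) + d v c * (real (card (W - U)) - real (card U))"
      by (simp add: sum.distrib sum_subtractf algebra_simps)
    also have "\<dots> = f v + d v c * (real (card (W - U)) - real (card U))"
      unfolding f_def using sum.subset_diff[OF UW finW(1), of "d v"] by (simp add: add.commute)
    finally have "f c \<le> f v + d v c * (real (card (W - U)) - real (card U))" .
    moreover have "card (W - U) < card U"
      using neg card_Diff_subset[OF finU UW] by (simp add: U_def K_def)
    then have "d v c * (real (card (W - U)) - real (card U)) < 0"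
      using cv by (simp add: mult_pos_neg)
    ultimately have "f c < f v" by linarith
    then show False using vmin c UW by force
  qed
  then show ?thesis using v unfolding W_def by blast
qed

(* The ball with the largest excess r i - d (c i) v over v swallows, inside every branch at v,
   all balls through v that are centered outside that branch. *)
lemma cf_on_combine:
  fixes c :: "'i \<Rightarrow> 'p" and r :: "'i \<Rightarrow> real"
  defines "b \<equiv> \<lambda>i. {x \<in> X. d (c i) x \<le> r i}"
  assumes RX: "R \<subseteq> X" and v: "v \<in> R" and finF: "finite F" and cR: "c ` F \<subseteq> R" and k: "k \<noteq> 0"
    and branches: "\<And>w S G. \<lbrakk>w \<in> R; w \<noteq> v; G \<subseteq> F; c ` G \<subseteq> branch R v w;
        S = {} \<or> (\<exists>i\<in>F. v \<in> b i \<and> S = b i)\<rbrakk> \<Longrightarrow>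
      \<exists>col. (\<forall>i. col i \<le> k) \<and> cf_on (branch R v w - S) G b col \<and>
        (\<forall>i\<in>G. col i = k \<longrightarrow> b i \<inter> S \<inter> insert v (branch R v w) = {})"
  shows "\<exists>col. (\<forall>i. col i \<le> k) \<and> cf_on R F b col"
proof -
  have vX: "v \<in> X" using v RX by auto
  have cX: "c i \<in> X" if "i \<in> F" for i using that cR RX by auto
  \<comment> \<open>\<open>T\<close> holds one index of largest excess over \<open>v\<close>, or is
    empty when no ball contains \<open>v\<close>, so both cases are treated at once.\<close>
  obtain T S where T: "T \<subseteq> F" "S = \<Union> (b ` T)" "S = {} \<and> T = {} \<or> (\<exists>i0\<in>F. v \<in> b i0 \<and> T = {i0} \<and> S = b i0)"
    and S: "\<And>i. \<lbrakk>i \<in> F; v \<in> b i\<rbrakk> \<Longrightarrow> \<exists>i0\<in>T. v \<in> b i0 \<and> r i - d (c i) v \<le> r i0 - d (c i0) v"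
  proof (cases "\<exists>i\<in>F. v \<in> b i")
    case True
    let ?F = "{i \<in> F. v \<in> b i}"
    have "finite ?F" "?F \<noteq> {}" using finF True by auto
    then obtain i0 where "i0 \<in> ?F" "\<And>i. i \<in> ?F \<Longrightarrow> r i - d (c i) v \<le> r i0 - d (c i0) v"
      using Max_in[of "(\<lambda>i. r i - d (c i) v) ` ?F"] Max_ge[of "(\<lambda>i. r i - d (c i) v) ` ?F"] by fastforce
    then show ?thesis using that[of "{i0}" "b i0"] by auto
  next
    case False
    then show ?thesis using that[of "{}" "{}"] by auto
  qed
  \<comment> \<open>A ball that reaches \<open>x\<close> through \<open>v\<close> has excess at
    least \<open>d v x\<close>, hence so has the ball in \<open>T\<close>.\<close>
  have swallow: "x \<in> S" and through: "v \<in> b i"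
    if hyps: "i \<in> F" "x \<in> b i" "x \<in> R" "between d (c i) v x" for i x
  proof -
    have xX: "x \<in> X" using that RX by auto
    have le: "d v x \<le> r i - d (c i) v" using that by (simp add: between_def b_def)
    then show vb: "v \<in> b i" using dist_nonneg[OF vX xX] vX by (simp add: b_def)
    obtain j where j: "j \<in> T" "r i - d (c i) v \<le> r j - d (c j) v" using S[OF hyps(1) vb] by blast
    have "d (c j) x \<le> d (c j) v + d v x" using triangle cX[of j] j T vX xX by blast
    then have "x \<in> b j" using le j xX by (simp add: b_def)
    then show "x \<in> S" using T j by blast
  qed
  define G where "G K = {i \<in> F - T. c i \<in> K}" for K
  have "\<forall>w\<in>R - {v}. \<exists>col. (\<forall>i. col i \<le> k) \<and> cf_on (branch R v w - S) (G (branch R v w)) b col \<and>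
        (\<forall>i\<in>G (branch R v w). col i = k \<longrightarrow> b i \<inter> S \<inter> insert v (branch R v w) = {})"
    using T(3) by (intro ballI branches) (auto simp: G_def)
  \<comment> \<open>Indexing by the branch as a set rather than by \<open>w\<close> gives all
    centers in one branch the same coloring.\<close>
  then have "\<forall>K\<in>branch R v ` (R - {v}). \<exists>col. (\<forall>i. col i \<le> k) \<and> cf_on (K - S) (G K) b col \<and>
        (\<forall>i\<in>G K. col i = k \<longrightarrow> b i \<inter> S \<inter> insert v K = {})" by blast
  then obtain cc where cc: "\<forall>K\<in>branch R v ` (R - {v}). (\<forall>i. cc K i \<le> k) \<and> cf_on (K - S) (G K) b (cc K) \<and>
        (\<forall>i\<in>G K. cc K i = k \<longrightarrow> b i \<inter> S \<inter> insert v K = {})" by metis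
  \<comment> \<open>Balls centered at \<open>v\<close> other than the one in \<open>T\<close> get
    the dummy color: within \<open>R\<close> they are contained in \<open>S\<close>.\<close>
  define col where "col i = (if i \<in> T then k else if i \<in> F \<and> c i \<noteq> v then cc (branch R v (c i)) i else 0)" for i
  have col_le: "col i \<le> k" for i using cc cR by (auto simp: col_def)
  have "cf_on R F b col" unfolding cf_on_def
  proof (intro ballI impI)
    fix x assume xR: "x \<in> R" and ex: "\<exists>i\<in>F. x \<in> b i"
    show "\<exists>i\<in>F. x \<in> b i \<and> col i \<noteq> 0 \<and> (\<forall>j\<in>F. x \<in> b j \<and> j \<noteq> i \<longrightarrow> col j \<noteq> col i)"
    proof (cases "x \<in> S")
      case True
      then obtain i0 where i0: "i0 \<in> F" "T = {i0}" "S = b i0" "v \<in> b i0" using T(3) by blast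
      \<comment> \<open>In its own branch and at \<open>v\<close>, a ball of color \<open>k\<close>
        avoids \<open>S\<close>. So \<open>x\<close> would lie outside that branch, and the ball
        would contain \<open>v\<close>, a point of \<open>S\<close>.\<close>
      have "col j \<noteq> k" if j: "j \<in> F" "x \<in> b j" "j \<noteq> i0" for j
      proof
        assume ck: "col j = k"
        then have cv: "c j \<noteq> v" using j i0 k by (auto simp: col_def)
        let ?K = "branch R v (c j)"
        have "cc ?K j = k" using ck j i0 cv by (auto simp: col_def)
        moreover have "j \<in> G ?K" using j i0 cv cR self_in_branch[of "c j" R v] RX v by (auto simp: G_def)
        moreover have "?K \<in> branch R v ` (R - {v})" using j cR cv by blast
        ultimately have dis: "b j \<inter> S \<inter> insert v ?K = {}" using cc by blast
        have "x \<notin> ?K" using dis True j by blast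
        then have "between d (c j) v x" using between_sym[of x "c j" v] cX j xR RX vX by (auto simp: branch_def)
        then have "v \<in> b j" using through j xR by blast
        then show False using dis i0 by blast
      qed
      then show ?thesis using i0 True k by (intro bexI[of _ i0]) (auto simp: col_def)
    next
      case False
      let ?K = "branch R v x"
      have xv: "x \<noteq> v"
      proof
        assume "x = v"
        then obtain j where "j \<in> T" "v \<in> b j" using ex S by blast
        then show False using False T \<open>x = v\<close> by blast
      qed
      have KK: "?K \<in> branch R v ` (R - {v})" using xv xR by blast
      \<comment> \<open>A ball containing \<open>x\<close> but not centered in its branch would pass
        through \<open>v\<close> and be swallowed, so \<open>x\<close> only sees balls of its own
        branch.\<close>
      have inG: "i \<in> G ?K \<and> col i = cc ?K i" if i: "i \<in> F" "x \<in> b i" for i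
      proof -
        have iT: "i \<notin> T" using False T i by blast
        have "\<not> between d (c i) v x" using swallow[OF i xR] False by blast
        then have cK: "c i \<in> ?K" using cR i by (auto simp: branch_def)
        then have "branch R v (c i) = ?K" using branch_eq[OF RX v xR] by blast
        moreover have "c i \<noteq> v" using cK center_not_in_branch[OF RX v] by auto
        ultimately show ?thesis using i iT cK by (auto simp: G_def col_def)
      qed
      have GF: "G ?K \<subseteq> F" by (auto simp: G_def)
      have "x \<in> ?K - S" using self_in_branch[OF xR RX v xv] False by blast
      moreover have "cf_on (?K - S) (G ?K) b (cc ?K)" using cc KK by blast
      moreover have "\<exists>i\<in>G ?K. x \<in> b i" using ex inG by blast
      ultimately obtain i where i: "i \<in> G ?K" "x \<in> b i" "cc ?K i \<noteq> 0"
        "\<forall>j\<in>G ?K. x \<in> b j \<and> j \<noteq> i \<longrightarrow> cc ?K j \<noteq> cc ?K i" unfolding cf_on_def by metis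
      then show ?thesis using inG GF by (intro bexI[of _ i]) (auto dest!: subsetD)
    qed
  qed
  then show ?thesis using col_le by blast
qed

text \<open>A leg, formed by \<open>v\<close> and one branch, embeds isometrically in the line by
  \<open>d v\<close>: the median of \<open>v\<close>, \<open>x\<close> and \<open>y\<close> lies in
  the branch, so it is neither \<open>v\<close> nor another node of \<open>V\<close>, which leaves
  \<open>x\<close> or \<open>y\<close>.\<close>

lemma dist_in_unbranched_branch:
  assumes R: "metric_convex R" and v: "v \<in> R" "V \<inter> R \<subseteq> {v}" and w: "w \<in> R"
    and xy: "x \<in> insert v (branch R v w)" "y \<in> insert v (branch R v w)"
  shows "d x y = \<bar>d v x - d v y\<bar>"
proof -
  have RX: "R \<subseteq> X" using R by (simp add: metric_convex_def)
  have X: "x \<in> X" "y \<in> X" "v \<in> X" "x \<in> R" "y \<in> R" using xy v RX by (auto simp: branch_def)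
  consider "x = v" | "y = v" | "x \<in> branch R v w" "y \<in> branch R v w" using xy by blast
  then show ?thesis
  proof cases
    case 3
    let ?K = "branch R v w"
    obtain m where m: "m \<in> {v, x, y} \<union> V" "between d v m x" "between d x m y" "between d v m y"
      using median[OF X(3,1,2)] by blast
    have mX: "m \<in> X" using m(1) X V_subset by auto
    have "m \<in> ?K" using metric_convexD[OF metric_convex_branch[OF R v(1) w] 3 mX m(3)] .
    then have "m \<in> R" "m \<noteq> v" using center_not_in_branch[OF RX v(1)] by (auto simp: branch_def)
    then have "m = x \<or> m = y" using m(1) v(2) by blast
    then show ?thesis using m X dist_nonneg[of x y] dist_sym[of x y] by (auto simp: between_def)
  qed (use X dist_refl[of v] dist_nonneg[of v x] dist_nonneg[of v y] dist_sym[of v x] in auto)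
qed

text \<open>On each leg the balls are intervals, so \<open>cf_on_intervals\<close> along
  \<open>d v\<close> supplies the branch colorings that \<open>cf_on_combine\<close> asks for with
  \<open>k = 2\<close>.\<close>

lemma cf_on_few_nodes:
  fixes c :: "'i \<Rightarrow> 'p" and r :: "'i \<Rightarrow> real"
  defines "b \<equiv> \<lambda>i. {x \<in> X. d (c i) x \<le> r i}"
  assumes R: "metric_convex R" and v: "v \<in> R" "V \<inter> R \<subseteq> {v}" and finF: "finite F" and cR: "c ` F \<subseteq> R"
  shows "\<exists>col. (\<forall>i. col i \<le> 2) \<and> cf_on R F b col"
  unfolding b_def
proof (rule cf_on_combine[OF _ v(1) finF cR])
  show RX: "R \<subseteq> X" using R by (simp add: metric_convex_def)
  fix w S G
  assume w: "w \<in> R" "w \<noteq> v" and G: "G \<subseteq> F" "c ` G \<subseteq> branch R v w"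
    and S: "S = {} \<or> (\<exists>i\<in>F. v \<in> {x \<in> X. d (c i) x \<le> r i} \<and> S = {x \<in> X. d (c i) x \<le> r i})"
  let ?K = "insert v (branch R v w)"
  note leg = dist_in_unbranched_branch[OF R v w(1)]
  have vX: "v \<in> X" using v RX by auto
  have KX: "?K \<subseteq> X" "?K \<subseteq> R" using v RX by (auto simp: branch_def)
  \<comment> \<open>Adding \<open>v\<close> to the branch makes the balls of color 2 avoid
    \<open>S\<close> at \<open>v\<close> too.\<close>
  have "\<exists>col. (\<forall>i. col i \<le> 2) \<and> cf_on (?K - S) G b col \<and> (\<forall>i\<in>G. col i = 2 \<longrightarrow> b i \<inter> S \<inter> ?K = {})"
  proof (rule cf_on_intervals[where \<phi> = "d v"])
    show "finite G" using G finF finite_subset by blast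
    show "z \<in> b i" if "i \<in> G" "x \<in> b i" "y \<in> b i" "x \<in> ?K" "y \<in> ?K" "z \<in> ?K" "d v x \<le> d v z" "d v z \<le> d v y" for i x y z
    proof -
      have "c i \<in> ?K" using G that by blast
      then have "d (c i) z \<le> r i"
        using leg[of "c i" x] leg[of "c i" y] leg[of "c i" z] that by (auto simp: b_def)
      then show ?thesis using KX that by (auto simp: b_def)
    qed
    show "z \<in> S" if x: "x \<in> S" "x \<in> ?K" and z: "z \<in> ?K" "d v z \<le> d v x" for x z
    proof -
      obtain i where i: "i \<in> F" "v \<in> b i" "S = b i" using S x by (auto simp: b_def)
      have X: "c i \<in> X" "c i \<in> R" "x \<in> X" "z \<in> X" using i cR RX x z KX by auto
      \<comment> \<open>If the center is on the leg, the ball is an interval containing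
        \<open>v\<close> and \<open>x\<close>, hence \<open>z\<close>. Otherwise it reaches
        \<open>x\<close> through \<open>v\<close> and so reaches every point no farther from
        \<open>v\<close>.\<close>
      have "d (c i) z \<le> r i"
      proof (cases "c i \<in> ?K")
        case True
        then show ?thesis
          using leg[of "c i" x] leg[of "c i" z] leg[of "c i" v] x z i dist_nonneg[OF vX X(4)] dist_refl[OF vX]
          by (auto simp: b_def)
      next
        case False
        then have "between d (c i) v w" using X by (auto simp: branch_def)
        have "between d (c i) v x"
        proof (cases "x = v")
          case True then show ?thesis using dist_refl[OF vX] by (simp add: between_def)
        next
          case False
          then have "branch R v x = branch R v w" using branch_eq[OF RX v(1) w(1)] x by blast
          then show ?thesis using \<open>c i \<notin> ?K\<close> X by (auto simp: branch_def)
        qed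
        then have "d (c i) v + d v x \<le> r i" using x i by (simp add: between_def b_def)
        then show ?thesis using triangle[OF X(1) vX X(4)] z by linarith
      qed
      then show ?thesis using i X by (simp add: b_def)
    qed
  qed
  then show "\<exists>col. (\<forall>i. col i \<le> 2) \<and> cf_on (branch R v w - S) G (\<lambda>i. {x \<in> X. d (c i) x \<le> r i}) col \<and>
      (\<forall>i\<in>G. col i = 2 \<longrightarrow> {x \<in> X. d (c i) x \<le> r i} \<inter> S \<inter> insert v (branch R v w) = {})"
    unfolding b_def cf_on_def by blast
qed simp

text \<open>Cutting at a centroid halves the number of nodes, so the strict bound by a power of two
  drops to the previous power at the price of one color. At \<open>k = 0\<close> at most one node is
  left. The dummy color included, \<open>k + 3\<close> colors are available.\<close>

lemma cf_on_balls:
  fixes c :: "'i \<Rightarrow> 'p" and r :: "'i \<Rightarrow> real"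
  assumes "metric_convex R" "finite (V \<inter> R)" "card (V \<inter> R) < 2 ^ Suc k" "finite F" "c ` F \<subseteq> R"
  shows "\<exists>col. (\<forall>i. col i \<le> k + 2) \<and> cf_on R F (\<lambda>i. {x \<in> X. d (c i) x \<le> r i}) col"
  using assms
proof (induction k arbitrary: R F)
  case 0
  show ?case
  proof (cases "R = {}")
    case True then show ?thesis by (intro exI[of _ "\<lambda>_. 0"]) (simp add: cf_on_def)
  next
    case False
    \<comment> \<open>Without a node, any point of \<open>R\<close> serves as the cut point.\<close>
    obtain v where v: "v \<in> R" "V \<inter> R \<subseteq> {v}"
    proof (cases "V \<inter> R = {}")
      case True
      then show ?thesis using that False by blast
    next
      case nonempty: False
      have "card (V \<inter> R) = 1" using 0(3) nonempty card_gt_0_iff[of "V \<inter> R"] 0(2) by auto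
      then obtain v where "V \<inter> R = {v}" using card_1_singletonE by blast
      then show ?thesis using that[of v] by blast
    qed
    show ?thesis using cf_on_few_nodes[OF 0(1) v 0(4,5)] by (simp only: add_0)
  qed
next
  case (Suc k)
  show ?case
  proof (cases "V \<inter> R = {}")
    case True
    \<comment> \<open>There is no centroid without a node, but then the bound for the smaller
      \<open>k\<close> already holds.\<close>
    then have "card (V \<inter> R) < 2 ^ Suc k" by simp
    then obtain col where "\<And>i. col i \<le> k + 2" "cf_on R F (\<lambda>i. {x \<in> X. d (c i) x \<le> r i}) col"
      using Suc.IH[OF Suc.prems(1,2) _ Suc.prems(4,5)] by blast
    then show ?thesis by (intro exI[of _ col]) (simp add: le_SucI)
  next
    case False
    obtain v where v: "v \<in> V \<inter> R" "\<And>w. w \<in> R \<Longrightarrow> 2 * card (V \<inter> branch R v w) \<le> card (V \<inter> R)"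
      using centroid[OF Suc.prems(1,2) False] by blast
    have RX: "R \<subseteq> X" using Suc.prems by (simp add: metric_convex_def)
    show ?thesis
    proof (rule cf_on_combine[OF RX _ Suc.prems(4,5)])
      fix w S G
      assume w: "w \<in> R" and G: "G \<subseteq> F" "c ` G \<subseteq> branch R v w"
      have "\<exists>col. (\<forall>i. col i \<le> k + 2) \<and> cf_on (branch R v w) G (\<lambda>i. {x \<in> X. d (c i) x \<le> r i}) col"
      proof (rule Suc.IH)
        show "metric_convex (branch R v w)" using metric_convex_branch Suc.prems v w by blast
        show "finite (V \<inter> branch R v w)"
          by (rule finite_subset[OF _ Suc.prems(2)]) (auto simp: branch_def)
        show "card (V \<inter> branch R v w) < 2 ^ Suc k" using v(2)[OF w] Suc.prems(3) by simp
        show "finite G" using G Suc.prems finite_subset by blast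
      qed fact
      then obtain col where col: "\<And>i. col i \<le> k + 2"
        "cf_on (branch R v w) G (\<lambda>i. {x \<in> X. d (c i) x \<le> r i}) col" by blast
      show "\<exists>col. (\<forall>i. col i \<le> Suc k + 2) \<and> cf_on (branch R v w - S) G (\<lambda>i. {x \<in> X. d (c i) x \<le> r i}) col \<and>
         (\<forall>i\<in>G. col i = Suc k + 2 \<longrightarrow> {x \<in> X. d (c i) x \<le> r i} \<inter> S \<inter> insert v (branch R v w) = {})"
      proof (intro exI conjI)
        show "\<forall>i. col i \<le> Suc k + 2" using col(1) by (simp add: le_SucI)
        show "cf_on (branch R v w - S) G (\<lambda>i. {x \<in> X. d (c i) x \<le> r i}) col"
          using col(2) unfolding cf_on_def by blast
        \<comment> \<open>The new color exceeds all colors of the recursive coloring, so this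
          condition is vacuous.\<close>
        show "\<forall>i\<in>G. col i = Suc k + 2 \<longrightarrow> {x \<in> X. d (c i) x \<le> r i} \<inter> S \<inter> insert v (branch R v w) = {}"
        proof (intro ballI impI)
          fix i assume "col i = Suc k + 2"
          then show "{x \<in> X. d (c i) x \<le> r i} \<inter> S \<inter> insert v (branch R v w) = {}"
            using col(1)[of i] by simp
        qed
      qed
    qed (use v in auto)
  qed
qed

end

section \<open>Gluing a segment to a tree metric\<close>

lemma between_real: "\<bar>a - c\<bar> + \<bar>c - b\<bar> = \<bar>a - b\<bar> \<longleftrightarrow> min a b \<le> c \<and> c \<le> max a (b :: real)"
  by (auto simp: abs_if min_def max_def)

(* The glued space is the part X \<times> {0} \<union> {u} \<times> {0..} of the l1-product of X and a ray. *)
locale attached_segment = tree_metric X d V for X :: "'p set" and d V +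
  fixes Y :: "'p set" and \<sigma> :: "'p \<Rightarrow> real" and u w :: 'p
  assumes u: "u \<in> V" and Y: "X \<inter> Y = {u}" and w: "w \<in> Y"
    and inj: "inj_on \<sigma> Y" and \<sigma>_u: "\<sigma> u = 0" and \<sigma>_nonneg: "\<And>y. y \<in> Y \<Longrightarrow> 0 \<le> \<sigma> y"
begin

text \<open>The coordinates of a point in the product; all points of the segment share the foot
  \<open>u\<close>.\<close>

definition foot :: "'p \<Rightarrow> 'p" where "foot x = (if x \<in> X then x else u)"
definition height :: "'p \<Rightarrow> real" where "height x = (if x \<in> X then 0 else \<sigma> x)"
definition glued :: "'p \<Rightarrow> 'p \<Rightarrow> real" where
  "glued x y = d (foot x) (foot y) + \<bar>height x - height y\<bar>"

lemma uX: "u \<in> X" using u V_subset by blast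

lemma foot_in: "foot x \<in> X" using uX by (simp add: foot_def)

lemma height_nonneg: "x \<in> X \<union> Y \<Longrightarrow> 0 \<le> height x"
  using \<sigma>_nonneg by (auto simp: height_def)

lemma foot_high: "x \<in> X \<union> Y \<Longrightarrow> 0 < height x \<Longrightarrow> foot x = u"
  by (auto simp: height_def foot_def split: if_splits)

lemma height_0: "x \<in> X \<union> Y \<Longrightarrow> height x = 0 \<longleftrightarrow> x \<in> X"
proof -
  assume x: "x \<in> X \<union> Y"
  have "x \<in> X" if "x \<in> Y" "\<sigma> x = 0"
    using inj_onD[OF inj, of x u] \<sigma>_u that Y by auto
  then show ?thesis using x by (auto simp: height_def)
qed

lemma foot_eq: "x \<in> X \<Longrightarrow> foot x = x" by (simp add: foot_def)

text \<open>In an l1-sum, equality in the triangle inequality splits into equality in both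
  coordinates.\<close>

lemma between_glued:
  assumes "x \<in> X \<union> Y" "y \<in> X \<union> Y" "z \<in> X \<union> Y"
  shows "between glued x z y \<longleftrightarrow> between d (foot x) (foot z) (foot y) \<and>
    min (height x) (height y) \<le> height z \<and> height z \<le> max (height x) (height y)"
  unfolding between_real[symmetric] between_def glued_def
  using triangle[OF foot_in foot_in foot_in, of x y z]
    abs_triangle_ineq[of "height x - height z" "height z - height y"] by auto

lemma between_ends: "x \<in> X \<Longrightarrow> y \<in> X \<Longrightarrow> between d x x y" "x \<in> X \<Longrightarrow> y \<in> X \<Longrightarrow> between d x y y"
  using dist_refl by (auto simp: between_def)

text \<open>The two coordinates interact only because positive height forces the foot
  \<open>u\<close>. The new end \<open>w\<close> joins \<open>V\<close> so that \<open>V\<close>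
  remains the full node set as the tree grows.\<close>

lemma tree_metric_glued: "tree_metric (X \<union> Y) glued (insert w V)"
proof
  show "insert w V \<subseteq> X \<union> Y" using V_subset w by auto
  show "glued x x = 0" for x using dist_refl foot_in by (simp add: glued_def)
  show "x = y" if xy: "x \<in> X \<union> Y" "y \<in> X \<union> Y" "glued x y = 0" for x y
  proof -
    have eq: "d (foot x) (foot y) = 0" "height x = height y"
      using xy(3) dist_nonneg[OF foot_in foot_in, of x y] by (auto simp: glued_def)
    then have "foot x = foot y" using dist_eqD foot_in by blast
    then show ?thesis
      using xy eq(2) height_0[OF xy(1)] height_0[OF xy(2)] inj_onD[OF inj, of x y]
      by (auto simp: foot_def height_def split: if_splits)
  qed
  show "glued x y = glued y x" for x y
    using dist_sym[OF foot_in foot_in, of x y] by (simp add: glued_def)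
  show "glued x z \<le> glued x y + glued y z" for x y z
    using triangle[OF foot_in foot_in foot_in, of x z y] by (simp add: glued_def)
next
  fix p q r v assume X: "p \<in> X \<union> Y" "q \<in> X \<union> Y" "r \<in> X \<union> Y" "v \<in> X \<union> Y"
    and b: "between glued p v r"
  note hn = X[THEN height_nonneg] and fh = X[THEN foot_high]
  have bd: "between d (foot p) (foot v) (foot r)" and
    hb: "min (height p) (height r) \<le> height v" "height v \<le> max (height p) (height r)"
    using b X between_glued by auto
  have u_between: "between d u u (foot x)" "between d (foot x) u u" for x
    using between_ends uX foot_in by auto
  show "between glued p v q \<or> between glued q v r"
  proof (cases "height v = 0")
    case False
    \<comment> \<open>Every point at least as high as \<open>v\<close> also has the foot
      \<open>u\<close>, so comparing the heights of \<open>q\<close> and \<open>v\<close>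
      decides.\<close>
    then have v: "0 < height v" "foot v = u" using hn fh by auto
    show ?thesis
      using hb v hn fh u_between unfolding between_glued[OF X(1,2,4)] between_glued[OF X(2,3,4)]
      by (smt (verit, best))
  next
    case True
    have "between d (foot p) (foot v) (foot q) \<or> between d (foot q) (foot v) (foot r)"
      using separation[OF foot_in foot_in foot_in foot_in bd] .
    \<comment> \<open>The feet decide unless the two points of the chosen alternative both have
      positive height. Then both feet are \<open>u\<close>, hence \<open>v\<close> is
      \<open>u\<close>, and the other alternative holds.\<close>
    moreover have "foot v = u" if "between d u (foot v) u"
      using that dist_nonneg[OF uX foot_in, of v] dist_nonneg[OF foot_in uX, of v] dist_refl[OF uX]
        dist_eqD[OF uX foot_in, of v]
      by (auto simp: between_def)
    ultimately show ?thesis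
      using True hb hn fh u_between unfolding between_glued[OF X(1,2,4)] between_glued[OF X(2,3,4)]
      by (smt (verit, best))
  qed
next
  fix p q r assume X: "p \<in> X \<union> Y" "q \<in> X \<union> Y" "r \<in> X \<union> Y"
  note hn = X[THEN height_nonneg]
  have "\<exists>m\<in>{p, q, r}. min (height p) (height q) \<le> height m \<and> height m \<le> max (height p) (height q) \<and>
    min (height q) (height r) \<le> height m \<and> height m \<le> max (height q) (height r) \<and>
    min (height p) (height r) \<le> height m \<and> height m \<le> max (height p) (height r)"
    by (auto simp: min_def max_def)
  then obtain m where m: "m \<in> {p, q, r}" and hm: "min (height p) (height q) \<le> height m" "height m \<le> max (height p) (height q)"
    "min (height q) (height r) \<le> height m" "height m \<le> max (height q) (height r)"
    "min (height p) (height r) \<le> height m" "height m \<le> max (height p) (height r)" by blast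
  have mX: "m \<in> X \<union> Y" using m X by auto
  show "\<exists>m\<in>{p, q, r} \<union> insert w V. between glued p m q \<and> between glued q m r \<and> between glued p m r"
  proof (cases "height m = 0")
    case False
    \<comment> \<open>Here \<open>m\<close> itself is the median: any two of the points include one
      at least as high as \<open>m\<close>, with foot \<open>u\<close>.\<close>
    then have "0 < height m" using height_nonneg[OF mX] by simp
    then have fm: "foot m = u" using foot_high[OF mX] by simp
    have "between d (foot x) u (foot y)" if "x \<in> X \<union> Y" "y \<in> X \<union> Y" "height m \<le> max (height x) (height y)" for x y
      using that \<open>0 < height m\<close> foot_high[of x] foot_high[of y] between_ends[OF uX foot_in] between_ends[OF foot_in uX]
      by (cases "height x \<le> height y") auto
    then show ?thesis using m hm fm X mX by (intro bexI[of _ m]) (auto simp: between_glued)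
  next
    case True
    obtain a where a: "a \<in> {foot p, foot q, foot r} \<union> V" "between d (foot p) a (foot q)"
      "between d (foot q) a (foot r)" "between d (foot p) a (foot r)"
      using median[OF foot_in foot_in foot_in] by blast
    have aX: "a \<in> X" using a(1) foot_in V_subset by auto
    \<comment> \<open>A foot is either the point itself or \<open>u\<close>, which is in
      \<open>V\<close>.\<close>
    have "a \<in> {p, q, r} \<union> V" using a(1) u by (auto simp: foot_def split: if_splits)
    moreover have "height a = 0" "foot a = a" using aX by (auto simp: height_def foot_def)
    ultimately show ?thesis
      using a aX hm True X hn by (intro bexI[of _ a]) (auto simp: between_glued)
  qed
qed

end

section \<open>The geodesic metric of a tree space\<close>

definition region :: "('p, 'e) network \<Rightarrow> 'p set \<Rightarrow> 'e set \<Rightarrow> 'p set" where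
  "region N S E = S \<union> (\<Union>e\<in>E. curve N e ` {0..len N e})"

text \<open>Each step hangs one new node on one new edge, the combinatorial form of
  \<open>attached_segment\<close>.\<close>

inductive subtree :: "('p, 'e) network \<Rightarrow> 'p set \<Rightarrow> 'e set \<Rightarrow> bool" for N where
  single: "v \<in> nodes N \<Longrightarrow> subtree N {v} {}"
| grow: "subtree N S E \<Longrightarrow> e \<in> edges N \<Longrightarrow> ends N e = {u, w} \<Longrightarrow> u \<in> S \<Longrightarrow> w \<notin> S \<Longrightarrow>
    subtree N (insert w S) (insert e E)"

lemma subtree_subset:
  assumes "network_space N" "subtree N S E"
  shows "S \<subseteq> nodes N \<and> E \<subseteq> edges N \<and> (\<forall>e\<in>E. ends N e \<subseteq> S)"
  using assms(2)
proof induction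
  case (grow S E e u w)
  have "ends N e \<subseteq> nodes N" using assms(1) grow by (auto simp: network_space_def)
  then show ?case using grow by auto
qed simp

text \<open>Edges are listed beside the nodes as in \<open>graph_cycle\<close>, so that one closing
  edge turns a path into a cycle.\<close>

definition graph_path :: "('p, 'e) network \<Rightarrow> 'p list \<Rightarrow> 'e list \<Rightarrow> bool" where
  "graph_path N vs es \<longleftrightarrow> length vs = Suc (length es) \<and> distinct vs \<and> distinct es \<and>
     (\<forall>i<length es. ends N (es ! i) = {vs ! i, vs ! Suc i})"

lemma graph_path_Cons:
  assumes "graph_path N vs es" "ends N e = {w, hd vs}" "w \<notin> set vs" "e \<notin> set es"
  shows "graph_path N (w # vs) (e # es)"
proof -
  have "vs \<noteq> []" using assms(1) by (auto simp: graph_path_def)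
  have "ends N ((e # es) ! i) = {(w # vs) ! i, (w # vs) ! Suc i}" if "i < Suc (length es)" for i
    using assms that \<open>vs \<noteq> []\<close> by (cases i) (auto simp: graph_path_def hd_conv_nth)
  then show ?thesis using assms by (simp add: graph_path_def)
qed

lemma graph_path_snoc:
  assumes "graph_path N vs es" "ends N e = {last vs, w}" "w \<notin> set vs" "e \<notin> set es"
  shows "graph_path N (vs @ [w]) (es @ [e])"
proof -
  have "vs \<noteq> []" using assms(1) by (auto simp: graph_path_def)
  have "ends N ((es @ [e]) ! i) = {(vs @ [w]) ! i, (vs @ [w]) ! Suc i}" if "i < Suc (length es)" for i
    using assms that \<open>vs \<noteq> []\<close>
    by (cases "i = length es") (auto simp: graph_path_def nth_append last_conv_nth)
  then show ?thesis using assms by (simp add: graph_path_def)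
qed

text \<open>A path to the new node runs to \<open>u\<close> inside the old subtree and then along
  \<open>e\<close>. Such paths close cycles with edges outside the subtree.\<close>

lemma subtree_path:
  assumes "network_space N" "subtree N S E"
  shows "\<forall>x\<in>S. \<forall>y\<in>S. \<exists>vs es. graph_path N vs es \<and> hd vs = x \<and> last vs = y \<and> set vs \<subseteq> S \<and> set es \<subseteq> E"
  using assms(2)
proof induction
  case (single v)
  show ?case by (intro ballI exI[of _ "[v]"] exI[of _ "[]"]) (simp add: graph_path_def)
next
  case (grow S E e u w)
  have eE: "e \<notin> E" using subtree_subset[OF assms(1) grow.hyps(1)] grow.hyps(3,5) by auto
  show ?case
  proof (intro ballI)
    fix x y assume x: "x \<in> insert w S" and y: "y \<in> insert w S"
    consider "x = w" "y = w" | "x = w" "y \<in> S" | "x \<in> S" "y = w" | "x \<in> S" "y \<in> S" using x y by blast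
    then show "\<exists>vs es. graph_path N vs es \<and> hd vs = x \<and> last vs = y \<and> set vs \<subseteq> insert w S \<and> set es \<subseteq> insert e E"
    proof cases
      case 1
      then show ?thesis by (intro exI[of _ "[w]"] exI[of _ "[]"]) (simp add: graph_path_def)
    next
      case 2
      obtain vs es where p: "graph_path N vs es" "hd vs = u" "last vs = y" "set vs \<subseteq> S" "set es \<subseteq> E"
        using bspec[OF bspec[OF grow.IH grow.hyps(4)] 2(2)] by blast
      have "graph_path N (w # vs) (e # es)"
        by (rule graph_path_Cons) (use p grow.hyps(3-5) eE in auto)
      moreover have "vs \<noteq> []" using p(1) by (auto simp: graph_path_def)
      ultimately show ?thesis using p 2 by (intro exI[of _ "w # vs"] exI[of _ "e # es"]) auto
    next
      case 3
      obtain vs es where p: "graph_path N vs es" "hd vs = x" "last vs = u" "set vs \<subseteq> S" "set es \<subseteq> E"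
        using bspec[OF bspec[OF grow.IH 3(1)] grow.hyps(4)] by blast
      have "graph_path N (vs @ [w]) (es @ [e])"
        by (rule graph_path_snoc) (use p grow.hyps(3-5) eE in auto)
      moreover have "vs \<noteq> []" using p(1) by (auto simp: graph_path_def)
      ultimately show ?thesis using p 3 by (intro exI[of _ "vs @ [w]"] exI[of _ "es @ [e]"]) auto
    next
      case 4
      then show ?thesis using bspec[OF bspec[OF grow.IH 4(1)] 4(2)] by blast
    qed
  qed
qed

text \<open>A subtree with inclusion-maximal node set spans: an edge leaving that set would let it
  grow, so by connectedness it contains all nodes.\<close>

lemma spanning_subtree:
  assumes N: "network_space N" and con: "graph_connected N"
  shows "\<exists>E. subtree N (nodes N) E"
proof -
  define T where "T = {S. \<exists>E. subtree N S E}"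
  have "T \<subseteq> Pow (nodes N)" using subtree_subset[OF N] unfolding T_def by blast
  moreover have "finite (nodes N)" "nodes N \<noteq> {}" using N by (auto simp: network_space_def)
  moreover from \<open>nodes N \<noteq> {}\<close> obtain v0 where "v0 \<in> nodes N" by blast
  then have "{v0} \<in> T" using subtree.single[of v0 N] unfolding T_def by blast
  ultimately have "finite T" "T \<noteq> {}" using finite_subset by auto
  then obtain S where S: "S \<in> T" "\<And>S'. S' \<in> T \<Longrightarrow> S \<subseteq> S' \<Longrightarrow> S = S'"
    using finite_has_maximal[of T] by blast
  obtain E where E: "subtree N S E" using S by (auto simp: T_def)
  have sub: "S \<subseteq> nodes N" using subtree_subset[OF N E] by blast
  obtain v where v: "v \<in> S" using E by cases auto
  have "x \<in> S" if "(v, x) \<in> {(x, y). \<exists>e\<in>edges N. ends N e = {x, y}}\<^sup>*" for x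
    using that
  proof induction
    case (step y z)
    then obtain e where e: "e \<in> edges N" "ends N e = {y, z}" by auto
    show ?case
    proof (rule ccontr)
      assume "z \<notin> S"
      then have "insert z S \<in> T" using subtree.grow[OF E e] step by (auto simp: T_def)
      then show False using S(2)[of "insert z S"] \<open>z \<notin> S\<close> by blast
    qed
  qed (rule v)
  then have "S = nodes N" using con v sub unfolding graph_connected_def by blast
  then show ?thesis using E by blast
qed

text \<open>An edge outside a spanning subtree would close a cycle with the subtree path joining its
  ends.\<close>

lemma tree_space_subtree:
  assumes "tree_space N"
  shows "subtree N (nodes N) (edges N)"
proof -
  have N: "network_space N" "graph_connected N" "\<nexists>vs es. graph_cycle N vs es"
    using assms by (simp_all add: tree_space_def)
  obtain E where E: "subtree N (nodes N) E" using spanning_subtree N by blast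
  have sub: "E \<subseteq> edges N" using subtree_subset[OF N(1) E] by blast
  have "f \<in> E" if f: "f \<in> edges N" for f
  proof (rule ccontr)
    assume fE: "f \<notin> E"
    have "ends N f \<subseteq> nodes N" using N f by (auto simp: network_space_def)
    then have "curve N f 0 \<in> nodes N" "curve N f (len N f) \<in> nodes N" by (auto simp: ends_def)
    then obtain vs es where p: "graph_path N vs es" "hd vs = curve N f 0" "last vs = curve N f (len N f)"
      "set vs \<subseteq> nodes N" "set es \<subseteq> E"
      using subtree_path[OF N(1) E] by blast
    have ne: "vs \<noteq> []" using p by (auto simp: graph_path_def)
    have "ends N ((es @ [f]) ! i) = {vs ! i, vs ! (Suc i mod length vs)}" if "i < length vs" for i
    proof (cases "i = length es")
      case True
      then have "ends N ((es @ [f]) ! i) = {hd vs, last vs}" using p(2,3) by (simp add: ends_def)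
      then show ?thesis using True p(1) ne by (auto simp: graph_path_def hd_conv_nth last_conv_nth)
    next
      case False
      then show ?thesis using that p(1) by (simp add: graph_path_def nth_append)
    qed
    moreover have "set es \<subseteq> edges N" "f \<notin> set es" using p(5) fE sub by auto
    ultimately have "graph_cycle N vs (es @ [f])"
      using p(1,4) ne f by (simp add: graph_cycle_def graph_path_def)
    then show False using N(3) by blast
  qed
  then have "E = edges N" using sub by blast
  then show ?thesis using E by simp
qed

section \<open>Path lengths and the metric on a growing subtree\<close>

lemma path_of_length_trans:
  "path_of_length N p q l \<Longrightarrow> path_of_length N q r m \<Longrightarrow> path_of_length N p r (l + m)"
proof (induction rule: path_of_length.induct)
  case (step e s t q l)
  then show ?case using path_of_length.step[of e N s t r "l + m"] by (simp add: add.assoc)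
qed simp

lemma path_of_length_edge:
  assumes "e \<in> edges N" "s \<in> {0..len N e}" "t \<in> {0..len N e}"
  shows "path_of_length N (curve N e s) (curve N e t) \<bar>s - t\<bar>"
proof -
  have "curve N e t \<in> points N" using assms unfolding points_def by blast
  then show ?thesis using path_of_length.step[OF assms path_of_length.refl] by simp
qed

(* The last two clauses say that leaves are never strictly between two points. They make
   the medians of the final tree internal nodes. *)
definition subtree_metric :: "('p, 'e) network \<Rightarrow> 'p set \<Rightarrow> 'e set \<Rightarrow> ('p \<Rightarrow> 'p \<Rightarrow> real) \<Rightarrow> bool" where
  "subtree_metric N S E D \<longleftrightarrow> tree_metric (region N S E) D S \<and>
     (\<forall>e\<in>E. \<forall>s\<in>{0..len N e}. \<forall>t\<in>{0..len N e}. D (curve N e s) (curve N e t) = \<bar>s - t\<bar>) \<and>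
     (\<forall>p\<in>region N S E. \<forall>q\<in>region N S E. path_of_length N p q (D p q)) \<and>
     (\<forall>z\<in>S. (\<forall>g\<in>E. z \<notin> ends N g) \<longrightarrow> region N S E = {z}) \<and>
     (\<forall>z\<in>S. \<forall>f. {g \<in> E. z \<in> ends N g} \<subseteq> {f} \<longrightarrow>
        (\<forall>p\<in>region N S E. \<forall>q\<in>region N S E. between D p z q \<longrightarrow> z = p \<or> z = q))"

text \<open>The new edge meets the old region only in \<open>u\<close>, so it can be glued on as a
  segment parametrized by arc length from \<open>u\<close>. Distances across \<open>u\<close> add up
  and are realized by concatenated paths.\<close>

lemma subtree_metric_grow:
  assumes N: "network_space N" and T: "subtree N S E" and D: "subtree_metric N S E D"
    and e: "e \<in> edges N" "ends N e = {u, w}" and u: "u \<in> S" and w: "w \<notin> S"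
  shows "\<exists>D. subtree_metric N (insert w S) (insert e E) D"
proof -
  define L where "L = len N e"
  define X where "X = region N S E"
  define Y where "Y = curve N e ` {0..L}"
  have sub: "S \<subseteq> nodes N" "E \<subseteq> edges N" "\<And>g. g \<in> E \<Longrightarrow> ends N g \<subseteq> S"
    using subtree_subset[OF N T] by auto
  have L: "0 < L" and injc: "inj_on (curve N e) {0..L}" and eN: "ends N e \<subseteq> nodes N"
    and int_e: "edge_interior N e \<inter> nodes N = {}"
    using N e by (auto simp: network_space_def L_def)
  have eE: "e \<notin> E" using sub(3)[of e] e w by auto
  have wN: "w \<in> nodes N" using eN e by auto
  have tm: "tree_metric X D S" and De: "\<And>g s t. \<lbrakk>g \<in> E; s \<in> {0..len N g}; t \<in> {0..len N g}\<rbrakk> \<Longrightarrow> D (curve N g s) (curve N g t) = \<bar>s - t\<bar>"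
    and Dp: "\<And>p q. \<lbrakk>p \<in> X; q \<in> X\<rbrakk> \<Longrightarrow> path_of_length N p q (D p q)"
    and D0: "\<And>z. \<lbrakk>z \<in> S; \<forall>g\<in>E. z \<notin> ends N g\<rbrakk> \<Longrightarrow> X = {z}"
    and D1: "\<And>z f p q. \<lbrakk>z \<in> S; {g \<in> E. z \<in> ends N g} \<subseteq> {f}; p \<in> X; q \<in> X; between D p z q\<rbrakk> \<Longrightarrow> z = p \<or> z = q"
    using D unfolding subtree_metric_def X_def by blast+
  have reg: "region N (insert w S) (insert e E) = X \<union> Y"
  proof -
    have "0 \<in> {0..L}" "L \<in> {0..L}" using L by auto
    then have "ends N e \<subseteq> Y" unfolding ends_def Y_def L_def by blast
    then show ?thesis using e(2) unfolding region_def X_def Y_def L_def by blast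
  qed
  have curve_cases: "curve N g s \<in> ends N g \<or> s \<in> {0<..<len N g}" if "s \<in> {0..len N g}" for g s
    using that by (cases "s = 0 \<or> s = len N g") (auto simp: ends_def)
  have X_cases: "x \<in> S \<or> (\<exists>g\<in>E. x \<in> edge_interior N g)" if x: "x \<in> X" for x
    using x sub(3) curve_cases unfolding X_def region_def edge_interior_def by blast
  have XN: "X \<inter> nodes N \<subseteq> S"
  proof
    fix x assume x: "x \<in> X \<inter> nodes N"
    have "edge_interior N g \<inter> nodes N = {}" if "g \<in> E" for g using N sub(2) that unfolding network_space_def by blast
    then show "x \<in> S" using X_cases x by blast
  qed
  have XI: "X \<inter> edge_interior N e = {}"
  proof -
    have "\<forall>f\<in>edges N. \<forall>g\<in>edges N. f \<noteq> g \<longrightarrow> edge_interior N f \<inter> edge_interior N g = {}"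
      using N by (simp add: network_space_def)
    then have "edge_interior N g \<inter> edge_interior N e = {}" if "g \<in> E" for g
      using that e(1) eE sub(2) by (metis subsetD)
    then show ?thesis using X_cases int_e sub(1) by (meson disjoint_iff subsetD)
  qed
  have uX: "u \<in> X" using u by (auto simp: X_def region_def)
  have wX: "w \<notin> X" using XN wN w by blast
  \<comment> \<open>The parametrization of \<open>e\<close> may start at either end.\<close>
  obtain a b where ab: "curve N e a = u" "curve N e b = w" "{a, b} = {0, L}"
    using e by (auto simp: ends_def L_def doubleton_eq_iff)
  have ab_in: "a \<in> {0..L}" "b \<in> {0..L}" using ab(3) L by (auto simp: doubleton_eq_iff)
  have Y_int: "y \<in> edge_interior N e \<or> y = u \<or> y = w" if y: "y \<in> Y" for y
  proof -
    obtain s where s: "s \<in> {0..L}" "y = curve N e s" using y by (auto simp: Y_def)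
    then have "y \<in> ends N e \<or> s \<in> {0<..<len N e}" using curve_cases[of s e] by (simp add: L_def)
    then show ?thesis using s(2) e(2) by (auto simp: edge_interior_def)
  qed
  have wY: "w \<in> Y" and uY: "u \<in> Y" using ab ab_in unfolding Y_def by blast+
  have XY: "X \<inter> Y = {u}" using Y_int XI wX uX uY by blast
  define \<sigma> where "\<sigma> y = \<bar>inv_into {0..L} (curve N e) y - a\<bar>" for y
  have \<sigma>: "\<sigma> (curve N e s) = \<bar>s - a\<bar>" if "s \<in> {0..L}" for s
    using inv_into_f_f[OF injc that] by (simp add: \<sigma>_def)
  have \<sigma>_diff: "\<bar>\<sigma> (curve N e s) - \<sigma> (curve N e t)\<bar> = \<bar>s - t\<bar>" if "s \<in> {0..L}" "t \<in> {0..L}" for s t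
    using \<sigma> that ab(3) by (auto simp: doubleton_eq_iff)
  interpret tree_metric X D S by (rule tm)
  interpret attached_segment X D S Y \<sigma> u w
  proof
    show "u \<in> S" by (rule u)
    show "X \<inter> Y = {u}" by (rule XY)
    show "w \<in> Y" by (rule wY)
    show "inj_on \<sigma> Y"
    proof (rule inj_onI)
      fix x y assume "x \<in> Y" "y \<in> Y" and eq: "\<sigma> x = \<sigma> y"
      then obtain s t where "s \<in> {0..L}" "t \<in> {0..L}" "x = curve N e s" "y = curve N e t" by (auto simp: Y_def)
      then show "x = y" using \<sigma>_diff[of s t] eq by simp
    qed
    show "\<sigma> u = 0" using \<sigma>[OF ab_in(1)] ab by simp
    show "0 \<le> \<sigma> y" for y by (simp add: \<sigma>_def)
  qed
  have height_Y: "height y = \<sigma> y" if "y \<in> Y" for y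
    using that XY \<sigma>_u by (auto simp: height_def)
  have foot_Y: "foot y = u" if "y \<in> Y" for y using that XY by (auto simp: foot_def)
  have hw: "height w = L" using height_Y[OF wY] \<sigma>[OF ab_in(2)] ab L by (auto simp: doubleton_eq_iff)
  have h_le: "height x \<le> L" if "x \<in> X \<union> Y" for x
    using that height_Y \<sigma> ab_in L by (cases "x \<in> Y") (auto simp: Y_def height_def)
  \<comment> \<open>As the only point of maximal height, \<open>w\<close> is never strictly between
    two points.\<close>
  have h_top: "x = w" if x: "x \<in> X \<union> Y" and h: "height x = L" for x
  proof -
    have "x \<in> Y" using h L x by (auto simp: height_def split: if_splits)
    then show ?thesis using h hw height_Y[OF wY] height_Y[of x] inj_onD[OF inj _ _ wY] by auto
  qed
  have glued_edge: "glued (curve N e s) (curve N e t) = \<bar>s - t\<bar>" if "s \<in> {0..L}" "t \<in> {0..L}" for s t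
    using that foot_Y height_Y \<sigma>_diff dist_refl[OF uX] by (simp add: glued_def Y_def)
  have path_edge: "path_of_length N p q (glued p q)" if "p \<in> Y" "q \<in> Y" for p q
    using that path_of_length_edge[OF e(1)] glued_edge by (auto simp: Y_def L_def)
  have glued_X: "glued p q = D p q" if "p \<in> X" "q \<in> X" for p q
    using that by (simp add: glued_def foot_def height_def)
  have glued_XY: "glued p q = glued p u + glued u q" "glued q p = glued q u + glued u p" if "p \<in> X" "q \<in> Y" for p q
    using that foot_Y[of q] uX dist_refl[OF uX] by (auto simp: glued_def foot_eq height_def)
  have "subtree_metric N (insert w S) (insert e E) glued"
    unfolding subtree_metric_def reg
  proof (intro conjI ballI allI impI)
    show "tree_metric (X \<union> Y) glued (insert w S)" by (rule tree_metric_glued)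
  next
    fix g s t assume g: "g \<in> insert e E" "s \<in> {0..len N g}" "t \<in> {0..len N g}"
    show "glued (curve N g s) (curve N g t) = \<bar>s - t\<bar>"
    proof (cases "g = e")
      case True then show ?thesis using g glued_edge by (simp add: L_def)
    next
      case False
      then have "g \<in> E" using g by blast
      moreover from this have "curve N g s \<in> X" "curve N g t \<in> X" using g(2,3) unfolding X_def region_def by blast+
      ultimately show ?thesis using g De glued_X by simp
    qed
  next
    fix p q assume "p \<in> X \<union> Y" "q \<in> X \<union> Y"
    then consider "p \<in> X" "q \<in> X" | "p \<in> X" "q \<in> Y" | "p \<in> Y" "q \<in> X" | "p \<in> Y" "q \<in> Y" by blast
    then show "path_of_length N p q (glued p q)"
    proof cases
      case 1 then show ?thesis using Dp glued_X by simp
    next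
      case 2
      have "path_of_length N p u (glued p u)" using Dp glued_X uX 2 by simp
      then show ?thesis using path_of_length_trans path_edge[OF uY 2(2)] glued_XY(1)[OF 2] by simp
    next
      case 3
      have "path_of_length N u q (glued u q)" using Dp glued_X uX 3 by simp
      then show ?thesis using path_of_length_trans path_edge[OF 3(1) uY] glued_XY(2)[OF 3(2,1)] by simp
    next
      case 4 then show ?thesis by (rule path_edge)
    qed
  next
    fix z assume z: "z \<in> insert w S" "\<forall>g\<in>insert e E. z \<notin> ends N g"
    \<comment> \<open>Such a \<open>z\<close> would be isolated in the old subtree and different
      from \<open>u\<close>, but then the old region would be \<open>z\<close> alone.\<close>
    then have "z \<in> S" "\<forall>g\<in>E. z \<notin> ends N g" "z \<noteq> u" using e by auto
    then show "X \<union> Y = {z}" using D0 uX by blast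
  next
    fix z f p q
    assume z: "z \<in> insert w S" "{g \<in> insert e E. z \<in> ends N g} \<subseteq> {f}" and pq: "p \<in> X \<union> Y" "q \<in> X \<union> Y"
      and b: "between glued p z q"
    have zXY: "z \<in> X \<union> Y" using z(1) wY by (auto simp: X_def region_def)
    have bz: "between D (foot p) (foot z) (foot q)" "min (height p) (height q) \<le> height z" "height z \<le> max (height p) (height q)"
      using b between_glued[OF pq zXY] by auto
    note hpq = pq[THEN h_le] pq[THEN h_top] pq[THEN height_nonneg] pq[THEN height_0]
    show "z = p \<or> z = q"
    proof (cases "z = w")
      case True
      then show ?thesis using bz(3) hpq hw by (auto simp: max_def split: if_splits)
    next
      case False
      then have zS: "z \<in> S" using z by blast
      then have zX: "z \<in> X" by (auto simp: X_def region_def)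
      have zE: "{g \<in> E. z \<in> ends N g} \<subseteq> {f}" using z by blast
      have hz: "height z = 0" "foot z = z" using zX by (auto simp: height_def foot_def)
      have pq0: "p \<in> X \<or> q \<in> X" using bz(2) hz hpq by (auto simp: min_def split: if_splits)
      show ?thesis
      proof (cases "z = u")
        case True
        \<comment> \<open>If \<open>e\<close> is the only edge at \<open>u\<close>, the old subtree
          had no edge there and is a single point.\<close>
        then have "f = e" using z e by auto
        then have "\<forall>g\<in>E. z \<notin> ends N g" using zE eE by auto
        then have "X = {z}" using D0 zS by blast
        then show ?thesis using pq0 by blast
      next
        case False
        \<comment> \<open>Any other old node keeps its edges, so the clause for the old metric
          applies to the feet.\<close>
        have "z = foot p \<or> z = foot q" using D1[OF zS zE foot_in foot_in] bz(1) hz by simp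
        then show ?thesis using False by (auto simp: foot_def split: if_splits)
      qed
    qed
  qed
  then show ?thesis by blast
qed

lemma subtree_metric_exists:
  assumes N: "network_space N" and "subtree N S E"
  shows "\<exists>D. subtree_metric N S E D"
  using assms(2)
proof induction
  case (single v)
  have "region N {v} {} = {v}" by (simp add: region_def)
  moreover have "path_of_length N v v 0" using single by (intro path_of_length.refl) (simp add: points_def)
  ultimately have "subtree_metric N {v} {} (\<lambda>_ _. 0)"
    by (auto simp: subtree_metric_def between_def intro!: tree_metric.intro)
  then show ?case by blast
next
  case (grow S E e u w)
  then show ?case using subtree_metric_grow[OF N] by blast
qed

text \<open>Some path has length \<open>D p q\<close>. Along any path the triangle inequality adds
  up the pieces, whose lengths are their \<open>D\<close>-distances, so no path is shorter.\<close>

lemma subtree_metric_geodesic_dist: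
  assumes N: "network_space N" and D: "subtree_metric N (nodes N) (edges N) D"
    and pq: "p \<in> points N" "q \<in> points N"
  shows "geodesic_dist N p q = D p q"
proof -
  have reg: "region N (nodes N) (edges N) = points N" by (simp add: region_def points_def)
  interpret tree_metric "points N" D "nodes N" using D unfolding subtree_metric_def reg by blast
  have in_points: "curve N e s \<in> points N" if "e \<in> edges N" "s \<in> {0..len N e}" for e s
    using that unfolding points_def by blast
  have le: "x \<in> points N \<and> y \<in> points N \<and> D x y \<le> l" if "path_of_length N x y l" for x y l
    using that
  proof induction
    case (refl p)
    then show ?case using dist_refl by simp
  next
    case (step e s t q l)
    have "D (curve N e s) (curve N e t) = \<bar>s - t\<bar>" using D step unfolding subtree_metric_def by blast
    then show ?case using step in_points triangle[of "curve N e s" "curve N e t" q] by auto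
  qed
  have "path_of_length N p q (D p q)" using D pq unfolding subtree_metric_def reg by blast
  then show ?thesis unfolding geodesic_dist_def by (intro cInf_eq_minimum) (use le in auto)
qed

text \<open>The metric grown along the whole tree has all nodes in \<open>V\<close>. A leaf has a
  single edge and is never strictly between two points, so a median other than the three given
  points is an internal node.\<close>

lemma tree_metric_tree_space:
  assumes "tree_space N"
  shows "tree_metric (points N) (geodesic_dist N) (internal_nodes N)"
proof -
  have N: "network_space N" using assms by (simp add: tree_space_def)
  obtain D where D: "subtree_metric N (nodes N) (edges N) D"
    using subtree_metric_exists[OF N tree_space_subtree[OF assms]] by blast
  have reg: "region N (nodes N) (edges N) = points N" by (simp add: region_def points_def)
  note geo = subtree_metric_geodesic_dist[OF N D]
  interpret tree_metric "points N" D "nodes N" using D unfolding subtree_metric_def reg by blast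
  have leaf: "z \<in> internal_nodes N \<or> z = p \<or> z = q"
    if z: "z \<in> nodes N" and pq: "p \<in> points N" "q \<in> points N" "between D p z q" for z p q
  proof (rule disjCI)
    assume "\<not> (z = p \<or> z = q)"
    have "\<nexists>f. {g \<in> edges N. z \<in> ends N g} \<subseteq> {f}"
      using D z pq \<open>\<not> (z = p \<or> z = q)\<close> unfolding subtree_metric_def reg by blast
    then have "degree N z \<noteq> 1" unfolding degree_def by (metis card_1_singletonE order_refl)
    then show "z \<in> internal_nodes N" using N z by (auto simp: network_space_def internal_nodes_def)
  qed
  have int: "internal_nodes N \<subseteq> points N" using V_subset by (auto simp: internal_nodes_def)
  show ?thesis
  proof
    show "internal_nodes N \<subseteq> points N" by (rule int)
    show "geodesic_dist N x x = 0" if "x \<in> points N" for x using that geo dist_refl by simp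
    show "x = y" if "x \<in> points N" "y \<in> points N" "geodesic_dist N x y = 0" for x y
      using that geo dist_eqD by simp
    show "geodesic_dist N x y = geodesic_dist N y x" if "x \<in> points N" "y \<in> points N" for x y
      using that geo dist_sym by simp
    show "geodesic_dist N x z \<le> geodesic_dist N x y + geodesic_dist N y z"
      if "x \<in> points N" "y \<in> points N" "z \<in> points N" for x y z
      using that geo triangle by simp
    show "between (geodesic_dist N) p v q \<or> between (geodesic_dist N) q v r"
      if "p \<in> points N" "q \<in> points N" "r \<in> points N" "v \<in> points N" "between (geodesic_dist N) p v r" for p q r v
      using that separation[of p q r v] by (simp add: between_def geo)
    show "\<exists>m\<in>{p, q, r} \<union> internal_nodes N. between (geodesic_dist N) p m q \<and>
        between (geodesic_dist N) q m r \<and> between (geodesic_dist N) p m r"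
      if X: "p \<in> points N" "q \<in> points N" "r \<in> points N" for p q r
    proof -
      obtain m where m: "m \<in> {p, q, r} \<union> nodes N" "between D p m q" "between D q m r" "between D p m r"
        using median[OF X] by blast
      have "m \<in> points N" using m X V_subset by auto
      moreover have "m \<in> {p, q, r} \<union> internal_nodes N" using m leaf[OF _ X(1,2)] by blast
      ultimately show ?thesis using m X by (intro bexI[of _ m]) (auto simp: between_def geo)
    qed
  qed
qed

section \<open>From tree metrics to the number of colors\<close>

theorem theorem6:
  fixes t n :: nat
  assumes "t \<ge> 1"
  shows "chi_CF_tree_balls TYPE('p \<times> 'e) t n \<le> enat (nat \<lceil>log 2 (real t)\<rceil> + 3)"
proof -
  define k where "k = nat \<lceil>log 2 (real t)\<rceil>"
  have "log 2 (real t) \<le> real k" unfolding k_def by linarith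
  then have "real t \<le> 2 powr real k" using assms by (simp add: log_le_iff)
  then have "real t \<le> real (2 ^ k)" by (simp add: powr_realpow)
  then have "t \<le> 2 ^ k" by (simp only: of_nat_le_iff)
  \<comment> \<open>\<open>cf_on_balls\<close> asks for a strict bound, by the next power of
    two.\<close>
  then have tk: "t < 2 ^ Suc k" using power_strict_increasing[of k "Suc k" "2 :: nat"] by linarith
  have "CF_colorable (points N) A (k + 3)"
    if N: "tree_space N" "card (internal_nodes N) = t" and A: "A \<subseteq> net_balls N" "finite A"
    for N :: "('p, 'e) network" and A
  proof -
    interpret tree_metric "points N" "geodesic_dist N" "internal_nodes N"
      using tree_metric_tree_space[OF N(1)] .
    have "\<forall>B\<in>A. \<exists>p r. p \<in> points N \<and> B = {x \<in> points N. geodesic_dist N p x \<le> r}"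
      using A(1) unfolding net_balls_def net_ball_def by blast
    \<comment> \<open>The balls as sets are their own indices, each with one chosen center and
      radius, so a ball with several centers gets one color.\<close>
    then obtain c r where cr: "\<And>B. B \<in> A \<Longrightarrow> c B \<in> points N \<and> B = {x \<in> points N. geodesic_dist N (c B) x \<le> r B}"
      by metis
    have int: "internal_nodes N \<inter> points N = internal_nodes N" using V_subset by blast
    have "\<exists>col. (\<forall>B. col B \<le> k + 2) \<and> cf_on (points N) A (\<lambda>B. {x \<in> points N. geodesic_dist N (c B) x \<le> r B}) col"
    proof (rule cf_on_balls)
      show "metric_convex (points N)" by (auto simp: metric_convex_def)
      \<comment> \<open>An infinite set would have \<open>card\<close> 0, but \<open>t\<close> is
        positive.\<close>
      show "finite (internal_nodes N \<inter> points N)"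
        using N(2) assms by (intro card_ge_0_finite) (simp add: int)
    qed (use N(2) tk A(2) cr in \<open>auto simp: int\<close>)
    then obtain col where col: "\<And>B. col B \<le> k + 2"
      "cf_on (points N) A (\<lambda>B. {x \<in> points N. geodesic_dist N (c B) x \<le> r B}) col" by blast
    have iff: "x \<in> {x \<in> points N. geodesic_dist N (c B) x \<le> r B} \<longleftrightarrow> x \<in> B" if "B \<in> A" for x B
      using cr[OF that] by blast
    have "conflict_free (points N) A col"
      unfolding conflict_free_def objects_at_def
    proof (intro ballI impI)
      fix x assume x: "x \<in> points N" "{B \<in> A. x \<in> B} \<noteq> {}"
      then have "\<exists>B\<in>A. x \<in> {x \<in> points N. geodesic_dist N (c B) x \<le> r B}" using iff by blast
      then obtain B where "B \<in> A" "x \<in> {x \<in> points N. geodesic_dist N (c B) x \<le> r B}"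
        "\<forall>B'\<in>A. x \<in> {x \<in> points N. geodesic_dist N (c B') x \<le> r B'} \<and> B' \<noteq> B \<longrightarrow> col B' \<noteq> col B"
        using col(2) x(1) unfolding cf_on_def by blast
      then show "\<exists>B\<in>{B \<in> A. x \<in> B}. \<forall>B'\<in>{B \<in> A. x \<in> B}. B' \<noteq> B \<longrightarrow> col B' \<noteq> col B"
        using iff by blast
    qed
    \<comment> \<open>The colors run from 0 to \<open>k + 2\<close>, with the dummy color
      counted.\<close>
    moreover have "col ` A \<subseteq> {..<k + 3}" using col(1) by (auto simp: less_Suc_eq_le numeral_3_eq_3 numeral_2_eq_2)
    ultimately show ?thesis unfolding CF_colorable_def by blast
  qed
  then show ?thesis
    unfolding chi_CF_tree_balls_def k_def[symmetric] by (intro Inf_lower) blast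
qed

end
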